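(* Let $k$ be a commutative ring, $A$ a commutative $k$-algebra, and $m$ a positive integer or $m=\infty$. Let $\delta,\varepsilon\in \mathrm{IDer}_k(A;m)$ be $m$-integrable derivations. Then the bracket $[\delta,\varepsilon]=\delta\varepsilon-\varepsilon\delta$ is also $m$-integrable.
   Context: A Hasse--Schmidt derivation of $A$ over $k$ of length $m$ ($m$ a positive integer or $\infty$) is a family $D=(D_n)_{0\leq n\leq m}$ (all $n\in\mathbb{N}$ if $m=\infty$) of $k$-linear maps $A\to A$ with $D_0=\mathrm{Id}_A$ and $D_n(xy)=\sum_{i+j=n}D_i(x)D_j(y)$ for all $x,y\in A$ and all such $n$. A $k$-derivation $\delta:A\to A$ is $m$-integrable (over $k$) if there is a Hasse--Schmidt derivation $D$ of $A$ over $k$ of length $m$ with $D_1=\delta$. $\mathrm{IDer}_k(A;m)$ denotes the set of $m$-integrable $k$-derivations of $A$. *)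

theory Defs
  imports "HOL-Algebra.Module" "HOL-Library.Extended_Nat"
begin

text \<open>
  A commutative \<open>k\<close>-algebra \<open>A\<close> is given by the locale predicate \<open>algebra k A\<close>. Maps \<open>A \<rightarrow> A\<close> are
  HOL functions of which only the values on \<open>carrier A\<close> matter, so two maps are regarded as equal
  when they agree on \<open>carrier A\<close>.
\<close>

definition k_linear ::
    "('k, 'r) ring_scheme \<Rightarrow> ('k, 'a, 'm) module_scheme \<Rightarrow> ('a \<Rightarrow> 'a) \<Rightarrow> bool" where
  "k_linear k A f \<longleftrightarrow>
     f \<in> carrier A \<rightarrow> carrier A \<and>
     (\<forall>x\<in>carrier A. \<forall>y\<in>carrier A. f (x \<oplus>\<^bsub>A\<^esub> y) = f x \<oplus>\<^bsub>A\<^esub> f y) \<and>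
     (\<forall>c\<in>carrier k. \<forall>x\<in>carrier A. f (c \<odot>\<^bsub>A\<^esub> x) = c \<odot>\<^bsub>A\<^esub> f x)"

definition k_derivation ::
    "('k, 'r) ring_scheme \<Rightarrow> ('k, 'a, 'm) module_scheme \<Rightarrow> ('a \<Rightarrow> 'a) \<Rightarrow> bool" where
  "k_derivation k A \<delta> \<longleftrightarrow>
     k_linear k A \<delta> \<and>
     (\<forall>x\<in>carrier A. \<forall>y\<in>carrier A.
        \<delta> (x \<otimes>\<^bsub>A\<^esub> y) = (\<delta> x \<otimes>\<^bsub>A\<^esub> y) \<oplus>\<^bsub>A\<^esub> (x \<otimes>\<^bsub>A\<^esub> \<delta> y))"

text \<open>
  A family of length \<open>m\<close> is a function on \<open>nat\<close> of which only the values at indices \<open>n\<close> with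
  \<open>enat n \<le> m\<close> matter; for \<open>m = \<infinity>\<close> these are all natural numbers.
\<close>

definition hasse_schmidt ::
    "('k, 'r) ring_scheme \<Rightarrow> ('k, 'a, 'm) module_scheme \<Rightarrow> enat \<Rightarrow> (nat \<Rightarrow> 'a \<Rightarrow> 'a) \<Rightarrow> bool" where
  "hasse_schmidt k A m D \<longleftrightarrow>
     (\<forall>n. enat n \<le> m \<longrightarrow> k_linear k A (D n)) \<and>
     (\<forall>x\<in>carrier A. D 0 x = x) \<and>
     (\<forall>n. enat n \<le> m \<longrightarrow> (\<forall>x\<in>carrier A. \<forall>y\<in>carrier A.
        D n (x \<otimes>\<^bsub>A\<^esub> y) = (\<Oplus>\<^bsub>A\<^esub>i\<in>{..n}. D i x \<otimes>\<^bsub>A\<^esub> D (n - i) y)))"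

definition m_integrable ::
    "('k, 'r) ring_scheme \<Rightarrow> ('k, 'a, 'm) module_scheme \<Rightarrow> enat \<Rightarrow> ('a \<Rightarrow> 'a) \<Rightarrow> bool" where
  "m_integrable k A m \<delta> \<longleftrightarrow>
     (\<exists>D. hasse_schmidt k A m D \<and> (\<forall>x\<in>carrier A. D 1 x = \<delta> x))"

definition IDer ::
    "('k, 'r) ring_scheme \<Rightarrow> ('k, 'a, 'm) module_scheme \<Rightarrow> enat \<Rightarrow> ('a \<Rightarrow> 'a) set" where
  "IDer k A m = {\<delta>. k_derivation k A \<delta> \<and> m_integrable k A m \<delta>}"

definition bracket ::
    "('k, 'a, 'm) module_scheme \<Rightarrow> ('a \<Rightarrow> 'a) \<Rightarrow> ('a \<Rightarrow> 'a) \<Rightarrow> 'a \<Rightarrow> 'a" where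
  "bracket A \<delta> \<epsilon> = (\<lambda>x. \<delta> (\<epsilon> x) \<ominus>\<^bsub>A\<^esub> \<epsilon> (\<delta> x))"

end

(* In terms of the automorphisms D(t) and E(s) attached to the two Hasse-Schmidt derivations, put
   C(s,t) = D(t) E(s), whose coefficient at s^a t^b is D_b E_a. Factor C = P Q, where P contains,
   besides its constant term 1, only monomials with a > b and Q only monomials with a <= b. This is
   a Birkhoff factorization: such P and Q exist uniquely among families of linear maps, and both
   satisfy the Leibniz rule, because each of the two sets of monomials is closed under
   multiplication. The monomials with a < b form an ideal in the span of those with a <= b, so the
   diagonal coefficients Q_(n,n) are a Hasse-Schmidt derivation. Comparing coefficients gives
   P_(1,0) = E_1, Q_(0,1) = D_1 and D_1 E_1 = Q_(1,1) + E_1 D_1, so Q_(1,1) is the bracket. *)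

theory Submission
  imports Defs "HOL-Library.Product_Plus"
begin

section \<open>Finite sums in abelian monoids and groups\<close>

lemma (in abelian_monoid) finsum_Sigma:
  assumes "finite I" "\<And>i. i \<in> I \<Longrightarrow> finite (A i)"
    and "\<And>i j. i \<in> I \<Longrightarrow> j \<in> A i \<Longrightarrow> g i j \<in> carrier G"
  shows "(\<Oplus>i\<in>I. \<Oplus>j\<in>A i. g i j) = (\<Oplus>z\<in>Sigma I A. g (fst z) (snd z))"
  using assms
proof (induction I rule: finite_induct)
  case empty
  then show ?case by simp
next
  case (insert i I)
  have eq: "Sigma (insert i I) A = Pair i ` A i \<union> Sigma I A"
    by auto
  have "(\<Oplus>z\<in>Pair i ` A i \<union> Sigma I A. g (fst z) (snd z))
      = (\<Oplus>z\<in>Pair i ` A i. g (fst z) (snd z)) \<oplus> (\<Oplus>z\<in>Sigma I A. g (fst z) (snd z))"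
    using insert by (intro finsum_Un_disjoint) auto
  also have "(\<Oplus>z\<in>Pair i ` A i. g (fst z) (snd z)) = (\<Oplus>j\<in>A i. g i j)"
    using insert.prems by (subst finsum_reindex) (auto simp: inj_on_def)
  finally show ?case
    using insert unfolding eq by (simp add: Pi_def)
qed

lemma (in abelian_monoid) finsum_reindex_bij:
  assumes "bij_betw h A B" "\<And>b. b \<in> B \<Longrightarrow> f b \<in> carrier G"
  shows "(\<Oplus>a\<in>A. f (h a)) = (\<Oplus>b\<in>B. f b)"
  using finsum_reindex[of f h A] assms by (auto simp: bij_betw_def Pi_def)

text \<open>Isolates one unknown term: in the argument for the Leibniz rule, two sums over all
  splittings agree and every summand but one is already known to match.\<close>

lemma (in abelian_group) finsum_eq_cancel:
  assumes "finite S" "t \<in> S"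
    and "\<And>s. s \<in> S \<Longrightarrow> f s \<in> carrier G" "\<And>s. s \<in> S \<Longrightarrow> g s \<in> carrier G"
    and "\<And>s. s \<in> S \<Longrightarrow> s \<noteq> t \<Longrightarrow> f s = g s"
    and "(\<Oplus>s\<in>S. f s) = (\<Oplus>s\<in>S. g s)"
  shows "f t = g t"
proof -
  have S: "S = insert t (S - {t})"
    using assms by auto
  have "(\<Oplus>s\<in>S - {t}. f s) = (\<Oplus>s\<in>S - {t}. g s)"
    using assms by (intro finsum_cong') auto
  moreover have "(\<Oplus>s\<in>S. f s) = f t \<oplus> (\<Oplus>s\<in>S - {t}. f s)"
    using assms by (subst S, subst finsum_insert) auto
  moreover have "(\<Oplus>s\<in>S. g s) = g t \<oplus> (\<Oplus>s\<in>S - {t}. g s)"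
    using assms by (subst S, subst finsum_insert) auto
  moreover have "(\<Oplus>s\<in>S - {t}. g s) \<in> carrier G"
    using assms by (intro finsum_closed) auto
  ultimately show ?thesis
    using assms by auto
qed

section \<open>Splittings of a bidegree\<close>

text \<open>A pair \<open>(a, b)\<close> stands for the exponent of s^a t^b and pairs add
  componentwise, so these are the summands of one coefficient in a product of two power
  series.\<close>

definition splits :: "nat \<times> nat \<Rightarrow> ((nat \<times> nat) \<times> (nat \<times> nat)) set" where
  "splits p = {s. fst s + snd s = p}"

lemma finite_splits [simp]: "finite (splits p)"
proof -
  have "splits p \<subseteq> ({..fst p} \<times> {..snd p}) \<times> ({..fst p} \<times> {..snd p})"
    by (auto simp: splits_def)
  then show ?thesis
    by (rule finite_subset) auto
qed

lemma splits_0 [simp]: "splits 0 = {(0, 0)}"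
  by (auto simp: splits_def prod_eq_iff)

text \<open>Both sides run over 2 x 2 arrays of bidegrees with rows \<open>q, q'\<close> and
  \<open>r, r'\<close> and total \<open>p\<close>. The left side groups them by row sums, the right
  side by column sums.\<close>

lemma (in abelian_monoid) finsum_splits_interchange:
  assumes "\<And>q q' r r'. f q q' r r' \<in> carrier G"
  shows "(\<Oplus>s\<in>splits p. \<Oplus>r\<in>splits (snd s). \<Oplus>q\<in>splits (fst s). f (fst q) (snd q) (fst r) (snd r))
       = (\<Oplus>s\<in>splits p. \<Oplus>a\<in>splits (fst s). \<Oplus>b\<in>splits (snd s). f (fst a) (fst b) (snd a) (snd b))"
    (is "?lhs = ?rhs")
proof -
  let ?S = "Sigma (splits p) (\<lambda>s. splits (snd s) \<times> splits (fst s))"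
  let ?T = "Sigma (splits p) (\<lambda>s. splits (fst s) \<times> splits (snd s))"
  \<comment> \<open>\<open>?h\<close> transposes the array and replaces its row sums by its column
    sums; \<open>?k\<close> transposes back.\<close>
  let ?h = "\<lambda>(s, r, q). ((fst q + fst r, snd q + snd r), (fst q, fst r), (snd q, snd r))"
  let ?k = "\<lambda>(s, a, b). ((fst a + fst b, snd a + snd b), (snd a, snd b), (fst a, fst b))"
  let ?g = "\<lambda>(s, a, b). f (fst a) (fst b) (snd a) (snd b)"
  have bij: "bij_betw ?h ?S ?T"
    by (rule bij_betw_byWitness[where f' = ?k]) (auto simp: splits_def ac_simps)
  have "?lhs = (\<Oplus>s\<in>splits p. \<Oplus>z\<in>splits (snd s) \<times> splits (fst s).
      f (fst (snd z)) (snd (snd z)) (fst (fst z)) (snd (fst z)))"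
    using assms by (intro finsum_cong' finsum_Sigma) (auto intro!: finsum_closed)
  also have "\<dots> = (\<Oplus>z\<in>?S. ?g (?h z))"
    using assms by (subst finsum_Sigma) (auto intro!: finsum_cong')
  also have "\<dots> = (\<Oplus>z\<in>?T. ?g z)"
    using assms by (intro finsum_reindex_bij[OF bij]) auto
  also have "\<dots> = (\<Oplus>s\<in>splits p. \<Oplus>z\<in>splits (fst s) \<times> splits (snd s).
      f (fst (fst z)) (fst (snd z)) (snd (fst z)) (snd (snd z)))"
    using assms by (subst finsum_Sigma) (auto intro!: finsum_cong')
  also have "\<dots> = ?rhs"
    using assms by (intro finsum_cong' finsum_Sigma[symmetric]) (auto intro!: finsum_closed)
  finally show ?thesis .
qed

section \<open>Linear maps of the algebra\<close>

context algebra
begin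

lemma k_linear_closed: "k_linear R M f \<Longrightarrow> x \<in> carrier M \<Longrightarrow> f x \<in> carrier M"
  by (auto simp: k_linear_def)

lemma k_linear_add:
  "k_linear R M f \<Longrightarrow> x \<in> carrier M \<Longrightarrow> y \<in> carrier M \<Longrightarrow> f (x \<oplus>\<^bsub>M\<^esub> y) = f x \<oplus>\<^bsub>M\<^esub> f y"
  by (auto simp: k_linear_def)

lemma k_linear_0: "k_linear R M f \<Longrightarrow> f \<zero>\<^bsub>M\<^esub> = \<zero>\<^bsub>M\<^esub>"
  using k_linear_add[of f "\<zero>\<^bsub>M\<^esub>" "\<zero>\<^bsub>M\<^esub>"] k_linear_closed[of f "\<zero>\<^bsub>M\<^esub>"]
  by (metis M.add.r_cancel_one' M.l_zero M.zero_closed)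

lemma k_linear_id: "k_linear R M (\<lambda>x. x)"
  by (auto simp: k_linear_def)

lemma k_linear_zero: "k_linear R M (\<lambda>x. \<zero>\<^bsub>M\<^esub>)"
  by (auto simp: k_linear_def)

lemma k_linear_if:
  "(b \<Longrightarrow> k_linear R M f) \<Longrightarrow> (\<not> b \<Longrightarrow> k_linear R M g) \<Longrightarrow> k_linear R M (\<lambda>x. if b then f x else g x)"
  by (cases b) auto

lemma k_linear_compose: "k_linear R M f \<Longrightarrow> k_linear R M g \<Longrightarrow> k_linear R M (\<lambda>x. f (g x))"
  by (auto simp: k_linear_def Pi_def)

lemma k_linear_diff:
  assumes "k_linear R M f" "k_linear R M g"
  shows "k_linear R M (\<lambda>x. f x \<ominus>\<^bsub>M\<^esub> g x)"
  using assms
  by (auto simp: k_linear_def Pi_def M.minus_eq M.minus_add M.a_ac smult_r_distr smult_r_minus)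

lemma k_linear_finsum:
  assumes "finite A" "\<And>i. i \<in> A \<Longrightarrow> k_linear R M (f i)"
  shows "k_linear R M (\<lambda>x. \<Oplus>\<^bsub>M\<^esub>i\<in>A. f i x)"
proof -
  have "(\<Oplus>\<^bsub>M\<^esub>i\<in>A. f i (x \<oplus>\<^bsub>M\<^esub> y)) = (\<Oplus>\<^bsub>M\<^esub>i\<in>A. f i x) \<oplus>\<^bsub>M\<^esub> (\<Oplus>\<^bsub>M\<^esub>i\<in>A. f i y)"
    if "x \<in> carrier M" "y \<in> carrier M" for x y
    using that assms
    by (subst M.finsum_addf[symmetric]) (auto simp: k_linear_def Pi_def simp del: M.finsum_addf intro!: M.finsum_cong')
  moreover have "(\<Oplus>\<^bsub>M\<^esub>i\<in>A. f i (c \<odot>\<^bsub>M\<^esub> x)) = c \<odot>\<^bsub>M\<^esub> (\<Oplus>\<^bsub>M\<^esub>i\<in>A. f i x)"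
    if "c \<in> carrier R" "x \<in> carrier M" for c x
    using that assms
    by (subst finsum_smult_ldistr) (auto simp: k_linear_def Pi_def intro!: M.finsum_cong')
  ultimately show ?thesis
    using assms by (auto simp: k_linear_def Pi_def intro!: M.finsum_closed)
qed

lemma k_linear_of_finsum:
  assumes "k_linear R M f" "finite A" "\<And>i. i \<in> A \<Longrightarrow> g i \<in> carrier M"
  shows "f (\<Oplus>\<^bsub>M\<^esub>i\<in>A. g i) = (\<Oplus>\<^bsub>M\<^esub>i\<in>A. f (g i))"
  using assms(2,3)
proof (induction A rule: finite_induct)
  case empty
  then show ?case using k_linear_0[OF assms(1)] by simp
next
  case (insert i A)
  then show ?case
    using assms(1) by (simp add: k_linear_add k_linear_closed Pi_def M.finsum_closed)
qed

section \<open>The Leibniz rule for families indexed by bidegrees\<close>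

text \<open>One coefficient of the multiplicativity F(xy) = F(x) F(y). Fixing \<open>p\<close>
  permits induction on bidegrees and lets the rule fail beyond the length \<open>m\<close>.\<close>

definition leibniz :: "(nat \<times> nat \<Rightarrow> 'c \<Rightarrow> 'c) \<Rightarrow> nat \<times> nat \<Rightarrow> bool" where
  "leibniz F p \<longleftrightarrow> (\<forall>x\<in>carrier M. \<forall>y\<in>carrier M.
     F p (x \<otimes>\<^bsub>M\<^esub> y) = (\<Oplus>\<^bsub>M\<^esub>s\<in>splits p. F (fst s) x \<otimes>\<^bsub>M\<^esub> F (snd s) y))"

lemma finsum_mult_finsum:
  assumes "finite A" "finite B"
    and "\<And>a. a \<in> A \<Longrightarrow> u a \<in> carrier M" "\<And>b. b \<in> B \<Longrightarrow> v b \<in> carrier M"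
  shows "(\<Oplus>\<^bsub>M\<^esub>a\<in>A. u a) \<otimes>\<^bsub>M\<^esub> (\<Oplus>\<^bsub>M\<^esub>b\<in>B. v b) = (\<Oplus>\<^bsub>M\<^esub>a\<in>A. \<Oplus>\<^bsub>M\<^esub>b\<in>B. u a \<otimes>\<^bsub>M\<^esub> v b)"
  using assms
  by (subst finsum_ldistr) (auto intro!: M.finsum_cong' M.finsum_closed finsum_rdistr)

text \<open>Expand C_p(xy) twice: by C = PQ applied to xy, and by the Leibniz rule for C with C = PQ
  inserted in both factors. After the interchange both are sums over \<open>splits p\<close>; the
  summands at \<open>s\<close> other than \<open>t\<close> agree, hence so do those at
  \<open>t\<close>. For \<open>t = (p, 0)\<close> or \<open>t = (0, p)\<close>, with identity
  constant terms, the conclusion is the Leibniz rule for P or Q at \<open>p\<close>.\<close>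

lemma leibniz_factor_term:
  assumes lin: "\<And>q. k_linear R M (P q)" "\<And>q. k_linear R M (Q q)"
    and C: "\<And>q x. x \<in> carrier M \<Longrightarrow> C q x = (\<Oplus>\<^bsub>M\<^esub>s\<in>splits q. P (fst s) (Q (snd s) x))"
    and "leibniz C p" "t \<in> splits p"
    and leib: "\<And>s. s \<in> splits p \<Longrightarrow> s \<noteq> t \<Longrightarrow> leibniz P (fst s) \<and> leibniz Q (snd s)"
    and x: "x \<in> carrier M" and y: "y \<in> carrier M"
  shows "P (fst t) (Q (snd t) (x \<otimes>\<^bsub>M\<^esub> y)) =
    (\<Oplus>\<^bsub>M\<^esub>r\<in>splits (snd t). \<Oplus>\<^bsub>M\<^esub>q\<in>splits (fst t).
       P (fst q) (Q (fst r) x) \<otimes>\<^bsub>M\<^esub> P (snd q) (Q (snd r) y))"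
proof -
  note closed [simp] = k_linear_closed[OF lin(1)] k_linear_closed[OF lin(2)] x y
  let ?T = "\<lambda>s. \<Oplus>\<^bsub>M\<^esub>r\<in>splits (snd s). \<Oplus>\<^bsub>M\<^esub>q\<in>splits (fst s).
       P (fst q) (Q (fst r) x) \<otimes>\<^bsub>M\<^esub> P (snd q) (Q (snd r) y)"
  have "P (fst s) (Q (snd s) (x \<otimes>\<^bsub>M\<^esub> y)) = ?T s" if "s \<in> splits p" "s \<noteq> t" for s
  proof -
    have "P (fst s) (Q (snd s) (x \<otimes>\<^bsub>M\<^esub> y))
        = P (fst s) (\<Oplus>\<^bsub>M\<^esub>r\<in>splits (snd s). Q (fst r) x \<otimes>\<^bsub>M\<^esub> Q (snd r) y)"
      using leib[OF that] by (simp add: leibniz_def)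
    also have "\<dots> = (\<Oplus>\<^bsub>M\<^esub>r\<in>splits (snd s). P (fst s) (Q (fst r) x \<otimes>\<^bsub>M\<^esub> Q (snd r) y))"
      by (intro k_linear_of_finsum lin) auto
    also have "\<dots> = ?T s"
      using leib[OF that]
      by (intro M.finsum_cong') (auto simp: leibniz_def intro!: M.finsum_closed)
    finally show ?thesis .
  qed
  moreover have "(\<Oplus>\<^bsub>M\<^esub>s\<in>splits p. P (fst s) (Q (snd s) (x \<otimes>\<^bsub>M\<^esub> y))) = (\<Oplus>\<^bsub>M\<^esub>s\<in>splits p. ?T s)"
  proof -
    have "(\<Oplus>\<^bsub>M\<^esub>s\<in>splits p. P (fst s) (Q (snd s) (x \<otimes>\<^bsub>M\<^esub> y))) = C p (x \<otimes>\<^bsub>M\<^esub> y)"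
      by (simp add: C)
    also have "\<dots> = (\<Oplus>\<^bsub>M\<^esub>s\<in>splits p. C (fst s) x \<otimes>\<^bsub>M\<^esub> C (snd s) y)"
      using \<open>leibniz C p\<close> by (simp add: leibniz_def)
    also have "\<dots> = (\<Oplus>\<^bsub>M\<^esub>s\<in>splits p. \<Oplus>\<^bsub>M\<^esub>a\<in>splits (fst s). \<Oplus>\<^bsub>M\<^esub>b\<in>splits (snd s).
       P (fst a) (Q (snd a) x) \<otimes>\<^bsub>M\<^esub> P (fst b) (Q (snd b) y))"
      by (intro M.finsum_cong') (auto simp: C finsum_mult_finsum intro!: M.finsum_closed)
    also have "\<dots> = (\<Oplus>\<^bsub>M\<^esub>s\<in>splits p. ?T s)"
      by (intro M.finsum_splits_interchange[symmetric]) auto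
    finally show ?thesis .
  qed
  ultimately show ?thesis
    using \<open>t \<in> splits p\<close>
    by (intro M.finsum_eq_cancel[of "splits p" t "\<lambda>s. P (fst s) (Q (snd s) (x \<otimes>\<^bsub>M\<^esub> y))" ?T])
      (auto intro!: M.finsum_closed)
qed

section \<open>Birkhoff factorization\<close>

text \<open>
  Comparing coefficients in \<open>C = P Q\<close> gives \<open>P\<^sub>p + Q\<^sub>p\<close>, and only one of the two is nonzero for
  \<open>p \<noteq> 0\<close>. The membership test repeated in the condition is there for the termination proof.
\<close>

function birkhoff :: "(nat \<times> nat \<Rightarrow> 'c \<Rightarrow> 'c) \<Rightarrow> nat \<times> nat \<Rightarrow> 'c \<Rightarrow> 'c" where
  "birkhoff C p x = C p x \<ominus>\<^bsub>M\<^esub> (\<Oplus>\<^bsub>M\<^esub>s\<in>splits p - {(p, 0), (0, p)}.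
     if s \<in> splits p - {(p, 0), (0, p)} \<and> snd (fst s) < fst (fst s) \<and> fst (snd s) \<le> snd (snd s)
     then birkhoff C (fst s) (birkhoff C (snd s) x) else \<zero>\<^bsub>M\<^esub>)"
  by auto
termination
  \<comment> \<open>The measure ignores the argument \<open>x\<close>, so the nested call is
    harmless; with \<open>(p, 0)\<close> and \<open>(0, p)\<close> removed, both parts of a
    splitting have smaller total degree.\<close>
  by (relation "measure (\<lambda>(C, p, x). fst p + snd p)") (auto simp: splits_def prod_eq_iff)

declare birkhoff.simps [simp del]

lemma k_linear_birkhoff:
  assumes C: "\<And>p. k_linear R M (C p)"
  shows "k_linear R M (birkhoff C p)"
proof (induction "fst p + snd p" arbitrary: p rule: less_induct)
  case less
  have summand: "k_linear R M (\<lambda>x. if s \<in> splits p - {(p, 0), (0, p)} \<and> snd (fst s) < fst (fst s)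
      \<and> fst (snd s) \<le> snd (snd s) then birkhoff C (fst s) (birkhoff C (snd s) x) else \<zero>\<^bsub>M\<^esub>)"
    for s
  \<comment> \<open>Membership supplies the smaller degrees that the induction hypothesis requires;
    otherwise the summand is constantly zero.\<close>
  proof (cases "s \<in> splits p - {(p, 0), (0, p)}")
    case True
    then have "fst (fst s) + snd (fst s) < fst p + snd p" "fst (snd s) + snd (snd s) < fst p + snd p"
      by (cases s; force simp: splits_def prod_eq_iff)+
    then have "k_linear R M (\<lambda>x. birkhoff C (fst s) (birkhoff C (snd s) x))"
      by (rule k_linear_compose[OF less less])
    then show ?thesis
      by (rule k_linear_if[OF _ k_linear_zero])
  qed (simp only: if_False simp_thms k_linear_zero)
  have lin: "k_linear R M (\<lambda>x. C p x \<ominus>\<^bsub>M\<^esub> (\<Oplus>\<^bsub>M\<^esub>s\<in>splits p - {(p, 0), (0, p)}.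
     if s \<in> splits p - {(p, 0), (0, p)} \<and> snd (fst s) < fst (fst s) \<and> fst (snd s) \<le> snd (snd s)
     then birkhoff C (fst s) (birkhoff C (snd s) x) else \<zero>\<^bsub>M\<^esub>))"
    by (intro k_linear_diff k_linear_finsum C summand) simp
  have eq: "birkhoff C p = (\<lambda>x. C p x \<ominus>\<^bsub>M\<^esub> (\<Oplus>\<^bsub>M\<^esub>s\<in>splits p - {(p, 0), (0, p)}.
     if s \<in> splits p - {(p, 0), (0, p)} \<and> snd (fst s) < fst (fst s) \<and> fst (snd s) \<le> snd (snd s)
     then birkhoff C (fst s) (birkhoff C (snd s) x) else \<zero>\<^bsub>M\<^esub>))"
    by (rule ext) (rule birkhoff.simps)
  show ?case
    using lin by (subst eq)
qed

lemma birkhoff_factorization: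
  assumes lin: "\<And>p. k_linear R M (C p)" and C0: "\<And>x. x \<in> carrier M \<Longrightarrow> C 0 x = x"
  obtains P Q where
    "\<And>q. k_linear R M (P q)" "\<And>q. k_linear R M (Q q)"
    "\<And>x. P 0 x = x" "\<And>x. Q 0 x = x"
    "\<And>q x. q \<noteq> 0 \<Longrightarrow> fst q \<le> snd q \<Longrightarrow> P q x = \<zero>\<^bsub>M\<^esub>"
    "\<And>q x. snd q < fst q \<Longrightarrow> Q q x = \<zero>\<^bsub>M\<^esub>"
    "\<And>q x. x \<in> carrier M \<Longrightarrow> C q x = (\<Oplus>\<^bsub>M\<^esub>s\<in>splits q. P (fst s) (Q (snd s) x))"
proof
  \<comment> \<open>Both factors are restrictions of the one family \<open>birkhoff C\<close>, to a
    > b and to a <= b. Index 0 is set to the identity outright, because \<open>C 0\<close> is the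
    identity only on the carrier.\<close>
  let ?P = "\<lambda>q x. if q = 0 then x else if snd q < fst q then birkhoff C q x else \<zero>\<^bsub>M\<^esub>"
  let ?Q = "\<lambda>q x. if q = 0 then x else if snd q < fst q then \<zero>\<^bsub>M\<^esub> else birkhoff C q x"
  note lin_birkhoff = k_linear_birkhoff[of C, OF lin]
  show linP: "k_linear R M (?P q)" for q
    by (intro k_linear_if k_linear_id k_linear_zero lin_birkhoff)
  show linQ: "k_linear R M (?Q q)" for q
    by (intro k_linear_if k_linear_id k_linear_zero lin_birkhoff)
  show "C p x = (\<Oplus>\<^bsub>M\<^esub>s\<in>splits p. ?P (fst s) (?Q (snd s) x))" if x: "x \<in> carrier M" for p x
  proof (cases "p = 0")
    case True
    then show ?thesis using x C0 by simp
  next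
    case False
    note closed [simp] = k_linear_closed[OF lin_birkhoff] k_linear_closed[OF lin] x
    define S where "S = splits p - {(p, 0), (0, p)}"
    define t where "t s = ?P (fst s) (?Q (snd s) x)" for s
    define u where "u s = (if s \<in> S \<and> snd (fst s) < fst (fst s) \<and> fst (snd s) \<le> snd (snd s)
      then birkhoff C (fst s) (birkhoff C (snd s) x) else \<zero>\<^bsub>M\<^esub>)" for s
    have t_closed [simp]: "t s \<in> carrier M" for s
      by (simp add: t_def)
    have splits: "splits p = insert (p, 0) (insert (0, p) S)"
      by (auto simp: S_def splits_def)
    have [simp]: "finite S" "(p, 0) \<notin> S" "(0, p) \<notin> S"
      by (simp_all add: S_def)
    have "t (p, 0) \<oplus>\<^bsub>M\<^esub> t (0, p) = birkhoff C p x"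
      using False by (simp add: t_def)
    \<comment> \<open>On \<open>S\<close> both indices are nonzero, so the case distinctions in
      \<open>?P\<close> and \<open>?Q\<close> become the guard of \<open>u\<close>. Where
      \<open>?Q\<close> vanishes, linearity sends the inner zero to zero.\<close>
    moreover have "t s = u s" if "s \<in> S" for s
    proof -
      have "fst s \<noteq> 0" "snd s \<noteq> 0"
        using that by (cases s; auto simp: S_def splits_def)+
      then show ?thesis
        using that k_linear_0[OF lin_birkhoff] by (simp add: t_def u_def)
    qed
    then have "(\<Oplus>\<^bsub>M\<^esub>s\<in>S. t s) = (\<Oplus>\<^bsub>M\<^esub>s\<in>S. u s)"
      by (intro M.finsum_cong') (auto simp: u_def)
    moreover have "birkhoff C p x = C p x \<ominus>\<^bsub>M\<^esub> (\<Oplus>\<^bsub>M\<^esub>s\<in>S. u s)"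
      unfolding u_def S_def by (subst birkhoff.simps) simp
    moreover have "(\<Oplus>\<^bsub>M\<^esub>s\<in>splits p. t s) = t (p, 0) \<oplus>\<^bsub>M\<^esub> (t (0, p) \<oplus>\<^bsub>M\<^esub> (\<Oplus>\<^bsub>M\<^esub>s\<in>S. t s))"
      using False by (simp add: splits)
    moreover have "(\<Oplus>\<^bsub>M\<^esub>s\<in>S. u s) \<in> carrier M"
      by (intro M.finsum_closed) (auto simp: u_def)
    ultimately have "(\<Oplus>\<^bsub>M\<^esub>s\<in>splits p. t s) = C p x"
      by (simp add: M.a_assoc[symmetric]) (simp add: M.minus_eq M.a_assoc M.l_neg)
    then show ?thesis
      by (simp add: t_def)
  qed
qed auto

text \<open>Induction on total degree. At each nonzero \<open>p\<close> one factor vanishes, and its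
  rule reads 0 = 0 since every product in the sum has a vanishing factor. This leaves a single
  unknown summand in C = PQ, which \<open>leibniz_factor_term\<close> determines. Only the rules for
  C at bidegrees below \<open>p\<close> enter, so a finite length \<open>m\<close> causes no
  trouble.\<close>

lemma leibniz_birkhoff:
  assumes lin: "\<And>q. k_linear R M (P q)" "\<And>q. k_linear R M (Q q)"
    and 0: "\<And>x. P 0 x = x" "\<And>x. Q 0 x = x"
    and P: "\<And>q x. q \<noteq> 0 \<Longrightarrow> fst q \<le> snd q \<Longrightarrow> P q x = \<zero>\<^bsub>M\<^esub>"
    and Q: "\<And>q x. snd q < fst q \<Longrightarrow> Q q x = \<zero>\<^bsub>M\<^esub>"
    and C: "\<And>q x. x \<in> carrier M \<Longrightarrow> C q x = (\<Oplus>\<^bsub>M\<^esub>s\<in>splits q. P (fst s) (Q (snd s) x))"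
    and leib: "\<And>q. fst q \<le> fst p \<Longrightarrow> snd q \<le> snd p \<Longrightarrow> leibniz C q"
  shows "leibniz P p \<and> leibniz Q p"
  using leib
proof (induction "fst p + snd p" arbitrary: p rule: less_induct)
  case less
  note closed [simp] = k_linear_closed[OF lin(1)] k_linear_closed[OF lin(2)]
  note factor = leibniz_factor_term[OF lin C less.prems]
  have split_p: "(p, 0) \<in> splits p" "(0, p) \<in> splits p"
    by (simp_all add: splits_def)
  have split_le: "fst (fst s) \<le> fst p" "snd (fst s) \<le> snd p" "fst (snd s) \<le> fst p" "snd (snd s) \<le> snd p"
    if "s \<in> splits p" for s
    using that by (auto simp: splits_def)
  have IH: "leibniz P q \<and> leibniz Q q" if "fst q \<le> fst p" "snd q \<le> snd p" "q \<noteq> p" for q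
  proof (rule less.hyps)
    show "fst q + snd q < fst p + snd p"
      using that by (auto simp: prod_eq_iff)
  qed (use that less.prems in auto)
  show ?case
  proof (cases "p = 0")
    case True
    then show ?thesis by (simp add: leibniz_def 0)
  next
    case False
    show ?thesis
    proof (cases "snd p < fst p")
      case True
      have "Q (fst s) x \<otimes>\<^bsub>M\<^esub> Q (snd s) y = \<zero>\<^bsub>M\<^esub>"
        if "s \<in> splits p" "x \<in> carrier M" "y \<in> carrier M" for s x y
      proof -
        have "snd (fst s) < fst (fst s) \<or> snd (snd s) < fst (snd s)"
          using that True by (auto simp: splits_def)
        then show ?thesis
          using that by (elim disjE) (simp_all add: Q)
      qed
      then have "leibniz Q p"
        using True by (simp add: leibniz_def Q M.add.finprod_one_eqI)
      \<comment> \<open>The splitting \<open>(0, p)\<close> uses the rule for Q at \<open>p\<close>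
        just proved; every other index that occurs is strictly below \<open>p\<close>.\<close>
      have "leibniz P (fst s) \<and> leibniz Q (snd s)" if "s \<in> splits p" "s \<noteq> (p, 0)" for s
      proof -
        have "fst s \<noteq> p"
          using that by (cases s) (auto simp: splits_def zero_prod_def)
        with that \<open>leibniz Q p\<close> show ?thesis
          using IH[of "fst s"] IH[of "snd s"] split_le[of s] by (cases "snd s = p") auto
      qed
      then have "leibniz P p"
        using factor[of p "(p, 0)"] split_p by (simp add: leibniz_def 0)
      with \<open>leibniz Q p\<close> show ?thesis by simp
    next
      case not_less: False
      have "P (fst s) x \<otimes>\<^bsub>M\<^esub> P (snd s) y = \<zero>\<^bsub>M\<^esub>"
        if "s \<in> splits p" "x \<in> carrier M" "y \<in> carrier M" for s x y
      proof -
        \<comment> \<open>If each part were 0 or had a > b, then \<open>p\<close> would be 0 or have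
          a > b as well.\<close>
        have "fst s \<noteq> 0 \<and> fst (fst s) \<le> snd (fst s) \<or> snd s \<noteq> 0 \<and> fst (snd s) \<le> snd (snd s)"
          using that False not_less by (auto simp: splits_def prod_eq_iff)
        then show ?thesis
          using that by (elim disjE conjE) (simp_all add: P)
      qed
      then have "leibniz P p"
        using False not_less by (simp add: leibniz_def P M.add.finprod_one_eqI)
      have "leibniz P (fst s) \<and> leibniz Q (snd s)" if "s \<in> splits p" "s \<noteq> (0, p)" for s
      proof -
        have "snd s \<noteq> p"
          using that by (cases s) (auto simp: splits_def zero_prod_def)
        with that \<open>leibniz P p\<close> show ?thesis
          using IH[of "fst s"] IH[of "snd s"] split_le[of s] by (cases "fst s = p") auto
      qed
      then have "leibniz Q p"
        using factor[of p "(0, p)"] split_p by (simp add: leibniz_def 0)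
      with \<open>leibniz P p\<close> show ?thesis by simp
    qed
  qed
qed

section \<open>Hasse-Schmidt derivations and two-parameter families\<close>

text \<open>Values beyond \<open>m\<close> are arbitrary functions, whereas the factorization asks
  for linear maps at all bidegrees. Replacing them by zero secures linearity and leaves the rules up
  to \<open>m\<close> intact.\<close>

lemma hasse_schmidt_truncate:
  assumes "hasse_schmidt R M m D"
  defines "D' \<equiv> \<lambda>n. if enat n \<le> m then D n else (\<lambda>x. \<zero>\<^bsub>M\<^esub>)"
  shows "hasse_schmidt R M m D'" "k_linear R M (D' n)"
proof -
  have D: "k_linear R M (D n)" if "enat n \<le> m" for n
    using assms(1) that by (simp add: hasse_schmidt_def)
  show "k_linear R M (D' n)"
    using D k_linear_zero by (simp add: D'_def)
  have "D' n (x \<otimes>\<^bsub>M\<^esub> y) = (\<Oplus>\<^bsub>M\<^esub>i\<in>{..n}. D' i x \<otimes>\<^bsub>M\<^esub> D' (n - i) y)"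
    if n: "enat n \<le> m" and "x \<in> carrier M" "y \<in> carrier M" for n x y
  proof -
    have le: "enat i \<le> m" if "i \<le> n" for i
      using n that by (meson enat_ord_simps(1) order_trans)
    have "D' n (x \<otimes>\<^bsub>M\<^esub> y) = (\<Oplus>\<^bsub>M\<^esub>i\<in>{..n}. D i x \<otimes>\<^bsub>M\<^esub> D (n - i) y)"
      using assms(1) that by (simp add: D'_def hasse_schmidt_def)
    also have "\<dots> = (\<Oplus>\<^bsub>M\<^esub>i\<in>{..n}. D' i x \<otimes>\<^bsub>M\<^esub> D' (n - i) y)"
      using that by (intro M.finsum_cong') (auto simp: D'_def le intro!: m_closed k_linear_closed[OF D])
    finally show ?thesis .
  qed
  then show "hasse_schmidt R M m D'"
    using assms(1) D k_linear_zero by (simp add: hasse_schmidt_def D'_def zero_enat_def[symmetric])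
qed

text \<open>Apply the rule for E, then the rule for D inside each summand. The two summation indices
  vary independently over a box, whose points are the first parts of the splittings of
  \<open>p\<close>.\<close>

lemma leibniz_compose:
  assumes D: "hasse_schmidt R M m D" and E: "hasse_schmidt R M m E"
    and lin: "\<And>n. k_linear R M (D n)" "\<And>n. k_linear R M (E n)"
    and "enat (fst p) \<le> m" "enat (snd p) \<le> m"
  shows "leibniz (\<lambda>q x. D (snd q) (E (fst q) x)) p"
  unfolding leibniz_def
proof (intro ballI)
  fix x y assume x [simp]: "x \<in> carrier M" and y [simp]: "y \<in> carrier M"
  note closed [simp] = k_linear_closed[OF lin(1)] k_linear_closed[OF lin(2)]
  let ?f = "\<lambda>s. D (snd (fst s)) (E (fst (fst s)) x) \<otimes>\<^bsub>M\<^esub> D (snd (snd s)) (E (fst (snd s)) y)"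
  let ?h = "\<lambda>(i, j). ((i, j), (fst p - i, snd p - j))"
  have bij: "bij_betw ?h ({..fst p} \<times> {..snd p}) (splits p)"
    by (rule bij_betw_byWitness[where f' = fst]) (auto simp: splits_def)
  have "D (snd p) (E (fst p) (x \<otimes>\<^bsub>M\<^esub> y))
      = D (snd p) (\<Oplus>\<^bsub>M\<^esub>i\<in>{..fst p}. E i x \<otimes>\<^bsub>M\<^esub> E (fst p - i) y)"
    using E assms(5) by (simp add: hasse_schmidt_def)
  also have "\<dots> = (\<Oplus>\<^bsub>M\<^esub>i\<in>{..fst p}. D (snd p) (E i x \<otimes>\<^bsub>M\<^esub> E (fst p - i) y))"
    by (intro k_linear_of_finsum lin) auto
  also have "\<dots> = (\<Oplus>\<^bsub>M\<^esub>i\<in>{..fst p}. \<Oplus>\<^bsub>M\<^esub>j\<in>{..snd p}.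
      D j (E i x) \<otimes>\<^bsub>M\<^esub> D (snd p - j) (E (fst p - i) y))"
    using D assms(6)
    by (intro M.finsum_cong') (auto simp: hasse_schmidt_def intro!: M.finsum_closed)
  also have "\<dots> = (\<Oplus>\<^bsub>M\<^esub>z\<in>{..fst p} \<times> {..snd p}. ?f (?h z))"
    by (subst M.finsum_Sigma) (auto intro!: M.finsum_cong')
  also have "\<dots> = (\<Oplus>\<^bsub>M\<^esub>s\<in>splits p. ?f s)"
    by (intro M.finsum_reindex_bij[OF bij]) auto
  finally show "D (snd p) (E (fst p) (x \<otimes>\<^bsub>M\<^esub> y)) = (\<Oplus>\<^bsub>M\<^esub>s\<in>splits p. ?f s)" .
qed

text \<open>If (a, b) + (c, d) = (n, n) with a different from b, then a > b or c > d, and Q vanishes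
  there. Only splittings into two diagonal bidegrees survive.\<close>

lemma hasse_schmidt_diagonal:
  assumes lin: "\<And>q. k_linear R M (Q q)"
    and Q0: "\<And>x. x \<in> carrier M \<Longrightarrow> Q 0 x = x"
    and Q: "\<And>q x. snd q < fst q \<Longrightarrow> Q q x = \<zero>\<^bsub>M\<^esub>"
    and leib: "\<And>n. enat n \<le> m \<Longrightarrow> leibniz Q (n, n)"
  shows "hasse_schmidt R M m (\<lambda>n. Q (n, n))"
proof -
  have "Q (n, n) (x \<otimes>\<^bsub>M\<^esub> y) = (\<Oplus>\<^bsub>M\<^esub>i\<in>{..n}. Q (i, i) x \<otimes>\<^bsub>M\<^esub> Q (n - i, n - i) y)"
    if n: "enat n \<le> m" and x: "x \<in> carrier M" and y: "y \<in> carrier M" for n x y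
  proof -
    note closed [simp] = k_linear_closed[OF lin] x y
    let ?h = "\<lambda>i. ((i, i), (n - i, n - i))"
    let ?f = "\<lambda>s. Q (fst s) x \<otimes>\<^bsub>M\<^esub> Q (snd s) y"
    have "?f s = \<zero>\<^bsub>M\<^esub>" if "s \<in> splits (n, n) - ?h ` {..n}" for s
    proof -
      obtain a b c d where s: "s = ((a, b), (c, d))"
        by (metis prod.exhaust)
      have "a + c = n" "b + d = n"
        using that by (auto simp: s splits_def)
      moreover have "a \<noteq> b"
        using that calculation by (auto simp: s image_iff)
      ultimately have "b < a \<or> d < c"
        by linarith
      then show ?thesis
        by (elim disjE) (simp_all add: s Q)
    qed
    moreover have "?h ` {..n} \<subseteq> splits (n, n)"
      by (auto simp: splits_def)
    ultimately have "(\<Oplus>\<^bsub>M\<^esub>s\<in>splits (n, n). ?f s) = (\<Oplus>\<^bsub>M\<^esub>s\<in>?h ` {..n}. ?f s)"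
      by (intro M.add.finprod_mono_neutral_cong_right) simp_all
    also have "\<dots> = (\<Oplus>\<^bsub>M\<^esub>i\<in>{..n}. ?f (?h i))"
      by (intro M.finsum_reindex) (auto simp: inj_on_def)
    finally show ?thesis
      using leib[OF n] x y by (simp add: leibniz_def)
  qed
  then show ?thesis
    using lin Q0 by (simp add: hasse_schmidt_def zero_prod_def)
qed

section \<open>First coefficients and the bracket\<close>

lemma hasse_schmidt_1_derivation:
  assumes "hasse_schmidt R M m D" "1 \<le> m"
  shows "k_derivation R M (D 1)"
proof -
  have 1: "enat 1 \<le> m"
    using assms(2) by (simp add: one_enat_def)
  then have lin: "k_linear R M (D 1)"
    using assms by (auto simp: hasse_schmidt_def)
  have "{..1::nat} = {0, 1}"
    by auto
  then show ?thesis
    using assms(1) 1 k_linear_closed[OF lin] lin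
    by (auto simp: k_derivation_def hasse_schmidt_def M.a_comm)
qed

lemma k_derivation_cong:
  assumes "k_derivation R M f" "\<And>x. x \<in> carrier M \<Longrightarrow> f x = g x"
  shows "k_derivation R M g"
  using assms by (auto simp: k_derivation_def k_linear_def Pi_def)

lemma splits_1_1: "splits (1, 1) =
    {((0, 0), (1, 1)), ((1, 1), (0, 0)), ((1, 0), (0, 1)), ((0, 1), (1, 0))}"
  by (auto simp: splits_def add_is_1)

lemma splits_1_0: "splits (1, 0) = {((0, 0), (1, 0)), ((1, 0), (0, 0))}"
  by (auto simp: splits_def add_is_1)

lemma splits_0_1: "splits (0, 1) = {((0, 0), (0, 1)), ((0, 1), (0, 0))}"
  by (auto simp: splits_def add_is_1)

lemma hasse_schmidt_bracket:
  assumes D: "hasse_schmidt R M m D" and E: "hasse_schmidt R M m E"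
    and lin: "\<And>n. k_linear R M (D n)" "\<And>n. k_linear R M (E n)"
  obtains G where "hasse_schmidt R M m G"
    "\<And>x. x \<in> carrier M \<Longrightarrow> G 1 x = D 1 (E 1 x) \<ominus>\<^bsub>M\<^esub> E 1 (D 1 x)"
proof -
  let ?C = "\<lambda>q x. D (snd q) (E (fst q) x)"
  have D0: "D 0 x = x" and E0: "E 0 x = x" if "x \<in> carrier M" for x
    using D E that by (auto simp: hasse_schmidt_def)
  obtain P Q where linP: "\<And>q. k_linear R M (P q)" and linQ: "\<And>q. k_linear R M (Q q)"
    and P0: "\<And>x. P 0 x = x" and Q0: "\<And>x. Q 0 x = x"
    and P: "\<And>q x. q \<noteq> 0 \<Longrightarrow> fst q \<le> snd q \<Longrightarrow> P q x = \<zero>\<^bsub>M\<^esub>"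
    and Q: "\<And>q x. snd q < fst q \<Longrightarrow> Q q x = \<zero>\<^bsub>M\<^esub>"
    and C: "\<And>q x. x \<in> carrier M \<Longrightarrow> ?C q x = (\<Oplus>\<^bsub>M\<^esub>s\<in>splits q. P (fst s) (Q (snd s) x))"
    by (rule birkhoff_factorization[of ?C]) (use D0 E0 k_linear_compose[OF lin] in auto)
  note closed [simp] = k_linear_closed[OF linP] k_linear_closed[OF linQ]
    k_linear_closed[OF lin(1)] k_linear_closed[OF lin(2)]
  have "leibniz Q (n, n)" if "enat n \<le> m" for n
  proof -
    \<comment> \<open>Bidegrees below \<open>(n, n)\<close> have both components at most
      \<open>m\<close>, where the rules for D and E are available.\<close>
    have "leibniz ?C q" if "fst q \<le> n" "snd q \<le> n" for q
      using that \<open>enat n \<le> m\<close>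
      by (intro leibniz_compose[OF D E lin]) (meson enat_ord_simps(1) order_trans)+
    then show ?thesis
      using leibniz_birkhoff[OF linP linQ P0 Q0 P Q C, of "(n, n)"] by simp
  qed
  then have "hasse_schmidt R M m (\<lambda>n. Q (n, n))"
    using linQ Q0 Q by (intro hasse_schmidt_diagonal) auto
  moreover have "Q (1, 1) x = D 1 (E 1 x) \<ominus>\<^bsub>M\<^esub> E 1 (D 1 x)" if x [simp]: "x \<in> carrier M" for x
  proof -
    note zero = P0[unfolded zero_prod_def] Q0[unfolded zero_prod_def]
    have P10: "P (1, 0) y = E 1 y" if [simp]: "y \<in> carrier M" for y
      using C[of y "(1, 0)"] by (simp add: splits_1_0 zero Q D0 del: One_nat_def)
    have Q01: "Q (0, 1) x = D 1 x"
      using C[of x "(0, 1)"] by (simp add: splits_0_1 zero P E0 zero_prod_def del: One_nat_def)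
    \<comment> \<open>Of the four splittings of \<open>(1, 1)\<close>, two drop out because P
      vanishes at \<open>(1, 1)\<close> and at \<open>(0, 1)\<close>. The others give
      \<open>Q (1, 1) x\<close> and P_(1,0) Q_(0,1), which is E_1 D_1.\<close>
    have "D 1 (E 1 x) = Q (1, 1) x \<oplus>\<^bsub>M\<^esub> E 1 (D 1 x)"
      using C[of x "(1, 1)"] by (simp add: splits_1_1 zero P P10 Q01 zero_prod_def del: One_nat_def)
    then show ?thesis
      by (simp add: M.minus_eq M.a_assoc M.r_neg)
  qed
  ultimately show ?thesis
    using that by blast
qed

end

theorem corollary3p7:
  fixes k :: "('k, 'r) ring_scheme" and A :: "('k, 'a, 'm) module_scheme"
    and m :: enat and \<delta> \<epsilon> :: "'a \<Rightarrow> 'a"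
  assumes "algebra k A"
    and "1 \<le> m"
    and "\<delta> \<in> IDer k A m"
    and "\<epsilon> \<in> IDer k A m"
  shows "bracket A \<delta> \<epsilon> \<in> IDer k A m"
proof -
  interpret algebra k A by fact
  have *: "\<exists>D. hasse_schmidt k A m D \<and> (\<forall>n. k_linear k A (D n)) \<and> (\<forall>x\<in>carrier A. D 1 x = \<gamma> x)"
    if \<gamma>: "\<gamma> \<in> IDer k A m" for \<gamma>
  proof -
    obtain D where D: "hasse_schmidt k A m D" "\<forall>x\<in>carrier A. D 1 x = \<gamma> x"
      using \<gamma> by (auto simp: IDer_def m_integrable_def)
    \<comment> \<open>As \<open>1 \<le> m\<close>, truncation leaves index 1 unchanged.\<close>
    with \<open>1 \<le> m\<close> show ?thesis
      using hasse_schmidt_truncate[OF D(1)]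
      by (intro exI[of _ "\<lambda>n. if enat n \<le> m then D n else (\<lambda>x. \<zero>\<^bsub>A\<^esub>)"]) (auto simp: one_enat_def)
  qed
  obtain D E where D: "hasse_schmidt k A m D" "\<And>n. k_linear k A (D n)" "\<forall>x\<in>carrier A. D 1 x = \<delta> x"
    and E: "hasse_schmidt k A m E" "\<And>n. k_linear k A (E n)" "\<forall>x\<in>carrier A. E 1 x = \<epsilon> x"
    using *[OF assms(3)] *[OF assms(4)] by blast
  obtain G where G: "hasse_schmidt k A m G"
    "\<And>x. x \<in> carrier A \<Longrightarrow> G 1 x = D 1 (E 1 x) \<ominus>\<^bsub>A\<^esub> E 1 (D 1 x)"
    using hasse_schmidt_bracket[OF D(1) E(1) D(2) E(2)] by metis
  have eq: "G 1 x = bracket A \<delta> \<epsilon> x" if "x \<in> carrier A" for x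
    using that G(2)[OF that] D(3) E(3) k_linear_closed[OF D(2), of x 1] k_linear_closed[OF E(2), of x 1]
    by (simp add: bracket_def)
  \<comment> \<open>The derivation property is read off from \<open>G 1\<close>, which agrees with
    the bracket on the carrier.\<close>
  moreover have "k_derivation k A (bracket A \<delta> \<epsilon>)"
    using k_derivation_cong[OF hasse_schmidt_1_derivation[OF G(1) \<open>1 \<le> m\<close>] eq] .
  ultimately show ?thesis
    using G(1) by (auto simp: IDer_def m_integrable_def)
qed

end
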